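(* Let $R$ be a commutative noetherian ring, let $\mathfrak{a}$ and $\mathfrak{b}$ be two ideals of $R$, and let $\mathcal{S}$ be a subcategory of $R$-Mod satisfying the $C_{\mathfrak{a}}$ and $C_{\mathfrak{b}}$ conditions. Then $\mathcal{S}$ satisfies the $C_{\mathfrak{a}+\mathfrak{b}}$ condition. In particular, if a subcategory $\mathcal{S}$ satisfies the $C_{\mathfrak{a}}$ condition for every principal ideal $\mathfrak{a}$ of $R$, then $\mathcal{S}$ satisfies the $C_{\mathfrak{a}}$ condition for every ideal $\mathfrak{a}$ of $R$.
   Context: $R$-Mod is the category of $R$-modules; all subcategories are full (identified with their classes of objects). For an ideal $\mathfrak{a}$ and an $R$-module $M$, $\Gamma_{\mathfrak{a}}(M)=\{m\in M : \mathfrak{a}^k m=0 \text{ for some } k\ge 1\}$ and $(0:_M\mathfrak{a})=\{m\in M:\mathfrak{a}m=0\}$. A class $\mathcal{S}$ of $R$-modules satisfies the $C_{\mathfrak{a}}$ condition if for every $R$-module $M$: $\Gamma_{\mathfrak{a}}(M)=M$ and $(0:_M\mathfrak{a})\in\mathcal{S}$ imply $M\in\mathcal{S}$. *)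

theory Defs
  imports "HOL-Algebra.Algebra"
begin

text \<open>A (full) subcategory of R-Mod is a set of objects. The type \<open>'m\<close> of module elements is a
  free type variable and plays the role of the universe in which R-Mod is formed.
  The fields \<open>mult\<close> and \<open>one\<close>, which module records inherit from ring records, carry no meaning.\<close>

definition R_Mod :: "('a, 'x) ring_scheme \<Rightarrow> ('a, 'm) module set"
  where "R_Mod R = {M. module R M}"

text \<open>The power \<open>\<aa>\<^sup>k\<close> is taken in the monoid of ideals of R, with \<open>\<aa>\<^sup>0 = R\<close>.\<close>

definition Gamma :: "('a, 'x) ring_scheme \<Rightarrow> 'a set \<Rightarrow> ('a, 'm) module \<Rightarrow> 'm set"
  where "Gamma R \<aa> M =
    {m \<in> carrier M. \<exists>k::nat. k \<ge> 1 \<and> (\<forall>x \<in> \<aa> [^]\<^bsub>ideals_set R\<^esub> k. x \<odot>\<^bsub>M\<^esub> m = \<zero>\<^bsub>M\<^esub>)}"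

definition zero_colon :: "('a, 'm) module \<Rightarrow> 'a set \<Rightarrow> 'm set"
  where "zero_colon M \<aa> = {m \<in> carrier M. \<forall>x \<in> \<aa>. x \<odot>\<^bsub>M\<^esub> m = \<zero>\<^bsub>M\<^esub>}"

text \<open>As an object of R-Mod, \<open>(0 :\<^sub>M \<aa>)\<close> is M with the carrier restricted.\<close>

definition C_condition ::
    "('a, 'x) ring_scheme \<Rightarrow> 'a set \<Rightarrow> ('a, 'm) module set \<Rightarrow> bool"
  where "C_condition R \<aa> \<S> \<longleftrightarrow>
    (\<forall>M \<in> R_Mod R. Gamma R \<aa> M = carrier M \<and> M\<lparr>carrier := zero_colon M \<aa>\<rparr> \<in> \<S> \<longrightarrow> M \<in> \<S>)"

lemma zero_colon_in_R_Mod: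
  assumes M: "M \<in> R_Mod R" and \<aa>: "ideal \<aa> R"
  shows "M\<lparr>carrier := zero_colon M \<aa>\<rparr> \<in> R_Mod R"
proof -
  interpret module R M using M by (simp add: R_Mod_def)
  interpret \<aa>: ideal \<aa> R by (rule \<aa>)
  have z: "x \<odot>\<^bsub>M\<^esub> \<zero>\<^bsub>M\<^esub> = \<zero>\<^bsub>M\<^esub>" if "x \<in> carrier R" for x
    using that by (rule smult_r_null)
  have "submodule (zero_colon M \<aa>) R M"
  proof (rule submoduleI)
    show "\<ominus>\<^bsub>M\<^esub> m \<in> zero_colon M \<aa>" if "m \<in> zero_colon M \<aa>" for m
      using that \<aa>.Icarr by (auto simp: zero_colon_def smult_r_minus)
    show "r \<odot>\<^bsub>M\<^esub> m \<in> zero_colon M \<aa>" if r: "r \<in> carrier R" and m: "m \<in> zero_colon M \<aa>" for r m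
    proof -
      have "x \<odot>\<^bsub>M\<^esub> (r \<odot>\<^bsub>M\<^esub> m) = \<zero>\<^bsub>M\<^esub>" if x: "x \<in> \<aa>" for x
      proof -
        have mc: "m \<in> carrier M" using m by (simp add: zero_colon_def)
        have "x \<odot>\<^bsub>M\<^esub> (r \<odot>\<^bsub>M\<^esub> m) = (x \<otimes>\<^bsub>R\<^esub> r) \<odot>\<^bsub>M\<^esub> m"
          using x r mc \<aa>.Icarr by (simp add: smult_assoc1)
        moreover have "x \<otimes>\<^bsub>R\<^esub> r \<in> \<aa>" using x r by (rule \<aa>.I_r_closed)
        ultimately show ?thesis using m by (simp add: zero_colon_def)
      qed
      then show ?thesis using r m by (simp add: zero_colon_def)
    qed
  qed (use \<aa>.Icarr z in \<open>auto simp: zero_colon_def smult_r_distr\<close>)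
  then show ?thesis
    unfolding R_Mod_def using submodule.submodule_is_module[OF _ module_axioms] by simp
qed

end

theory Submission
  imports Defs
begin

text \<open>
  The annihilator \<open>(0 :\<^sub>M \<aa> + \<bb>)\<close> can be computed in two stages: it is the \<open>\<bb>\<close>-annihilator of
  \<open>N = (0 :\<^sub>M \<aa>)\<close> (\<open>zero_colon_sum\<close>). If \<open>M\<close> is \<open>(\<aa> + \<bb>)\<close>-torsion, then it is both \<open>\<aa>\<close>-torsion and \<open>\<bb>\<close>-torsion, because
  \<open>\<Gamma>\<close> reverses inclusions of ideals (\<open>Gamma_antimono\<close>), and so its submodule \<open>N\<close> is \<open>\<bb>\<close>-torsion. Hence
  \<open>(0 :\<^sub>M \<aa> + \<bb>) \<in> \<S>\<close> gives \<open>N \<in> \<S>\<close> by the condition for \<open>\<bb>\<close>, and then \<open>M \<in> \<S>\<close> by the condition for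
  \<open>\<aa>\<close>. The two stages yield equal module records, not just isomorphic modules, so
  membership of the annihilator in \<open>\<S>\<close> carries over literally.

  The class of ideals for which the condition holds is therefore closed under sums
  (\<open>C_condition_sum\<close>). Over a noetherian ring every ideal is a finite sum of principal ideals, by
  splitting off one generator at a time (\<open>genideal_insert\<close>), so it is enough to have the
  condition for the principal ones.
\<close>

lemma ideal_prod_mono:
  assumes "I \<subseteq> I'" and "J \<subseteq> J'"
  shows "I \<cdot>\<^bsub>R\<^esub> J \<subseteq> I' \<cdot>\<^bsub>R\<^esub> J'"
proof
  fix x assume "x \<in> I \<cdot>\<^bsub>R\<^esub> J"
  then show "x \<in> I' \<cdot>\<^bsub>R\<^esub> J'"
    by induct (use assms in \<open>auto intro: ideal_prod.intros\<close>)
qed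

lemma ideals_pow_mono:
  assumes "I \<subseteq> J"
  shows "I [^]\<^bsub>ideals_set R\<^esub> (k::nat) \<subseteq> J [^]\<^bsub>ideals_set R\<^esub> k"
  by (induct k) (simp_all add: nat_pow_def ideals_set_def ideal_prod_mono assms)

lemma Gamma_antimono:
  assumes "\<aa> \<subseteq> \<cc>"
  shows "Gamma R \<cc> M \<subseteq> Gamma R \<aa> M"
  using ideals_pow_mono[OF assms] unfolding Gamma_def by fast

lemma Gamma_restrict_carrier:
  assumes "N \<subseteq> carrier M"
  shows "Gamma R \<aa> (M\<lparr>carrier := N\<rparr>) = N \<inter> Gamma R \<aa> M"
  using assms by (auto simp: Gamma_def)

lemma zero_colon_subset: "zero_colon M \<aa> \<subseteq> carrier M"
  by (auto simp: zero_colon_def)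

lemma (in ring) set_add_ideals_upper:
  assumes "ideal \<aa> R" and "ideal \<bb> R"
  shows "\<aa> \<subseteq> \<aa> <+> \<bb>" and "\<bb> \<subseteq> \<aa> <+> \<bb>"
proof -
  have "\<aa> \<union> \<bb> \<subseteq> carrier R"
    using assms by (auto intro: ideal.Icarr)
  then show "\<aa> \<subseteq> \<aa> <+> \<bb>" and "\<bb> \<subseteq> \<aa> <+> \<bb>"
    using genideal_self[of "\<aa> \<union> \<bb>"] by (simp_all add: union_genideal assms)
qed

text \<open>Annihilators turn sums of ideals into intersections, and the annihilator of \<open>\<bb>\<close> in a
  submodule is its intersection with the annihilator of \<open>\<bb>\<close> in the whole module.\<close>

lemma (in cring) zero_colon_sum:
  fixes M :: "('a, 'm) module"
  assumes "module R M" and \<aa>: "ideal \<aa> R" and \<bb>: "ideal \<bb> R"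
  shows "zero_colon (M\<lparr>carrier := zero_colon M \<aa>\<rparr>) \<bb> = zero_colon M (\<aa> <+> \<bb>)"
proof -
  interpret M: module R M by (rule assms(1))
  show ?thesis
  proof
    show "zero_colon M (\<aa> <+> \<bb>) \<subseteq> zero_colon (M\<lparr>carrier := zero_colon M \<aa>\<rparr>) \<bb>"
      using set_add_ideals_upper[OF \<aa> \<bb>] by (auto simp: zero_colon_def)
    show "zero_colon (M\<lparr>carrier := zero_colon M \<aa>\<rparr>) \<bb> \<subseteq> zero_colon M (\<aa> <+> \<bb>)"
    proof
      fix m assume "m \<in> zero_colon (M\<lparr>carrier := zero_colon M \<aa>\<rparr>) \<bb>"
      then have m: "m \<in> carrier M"
        and ann: "\<And>a. a \<in> \<aa> \<Longrightarrow> a \<odot>\<^bsub>M\<^esub> m = \<zero>\<^bsub>M\<^esub>" "\<And>b. b \<in> \<bb> \<Longrightarrow> b \<odot>\<^bsub>M\<^esub> m = \<zero>\<^bsub>M\<^esub>"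
        by (simp_all add: zero_colon_def)
      have "(a \<oplus> b) \<odot>\<^bsub>M\<^esub> m = \<zero>\<^bsub>M\<^esub>" if "a \<in> \<aa>" "b \<in> \<bb>" for a b
        using that m by (simp add: M.smult_l_distr ann ideal.Icarr[OF \<aa>] ideal.Icarr[OF \<bb>])
      with m show "m \<in> zero_colon M (\<aa> <+> \<bb>)"
        unfolding zero_colon_def set_add_def' by blast
    qed
  qed
qed

lemma (in cring) C_condition_sum:
  fixes \<C> :: "('a, 'm) module set"
  assumes \<aa>: "ideal \<aa> R" and \<bb>: "ideal \<bb> R"
    and C\<aa>: "C_condition R \<aa> \<C>" and C\<bb>: "C_condition R \<bb> \<C>"
  shows "C_condition R (\<aa> <+> \<bb>) \<C>"
  unfolding C_condition_def
proof (intro ballI impI, elim conjE)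
  fix M :: "('a, 'm) module"
  assume M: "M \<in> R_Mod R" and tors: "Gamma R (\<aa> <+> \<bb>) M = carrier M"
    and mem: "M\<lparr>carrier := zero_colon M (\<aa> <+> \<bb>)\<rparr> \<in> \<C>"
  interpret M: module R M using M by (simp add: R_Mod_def)
  have Gamma_carrier: "Gamma R I M \<subseteq> carrier M" for I
    by (auto simp: Gamma_def)
  have tors\<aa>: "Gamma R \<aa> M = carrier M" and tors\<bb>: "Gamma R \<bb> M = carrier M"
    using set_add_ideals_upper[OF \<aa> \<bb>, THEN Gamma_antimono[where M = M and R = R]] tors Gamma_carrier by blast+
  let ?N = "M\<lparr>carrier := zero_colon M \<aa>\<rparr>"
  have "Gamma R \<bb> ?N = carrier ?N"
    using zero_colon_subset[of M \<aa>] by (auto simp: Gamma_restrict_carrier tors\<bb>)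
  moreover have "?N\<lparr>carrier := zero_colon ?N \<bb>\<rparr> \<in> \<C>"
    using mem by (simp add: zero_colon_sum[OF M.module_axioms \<aa> \<bb>])
  ultimately have "?N \<in> \<C>"
    using C\<bb> zero_colon_in_R_Mod[OF M \<aa>] unfolding C_condition_def by blast
  then show "M \<in> \<C>"
    using C\<aa> M tors\<aa> unfolding C_condition_def by blast
qed

lemma (in ring) genideal_insert:
  assumes "a \<in> carrier R" and "A \<subseteq> carrier R"
  shows "Idl (insert a A) = Idl {a} <+> Idl A"
proof -
  have ideals: "ideal (Idl {a}) R" "ideal (Idl A) R" "ideal (Idl (insert a A)) R"
    using assms by (simp_all add: genideal_ideal)
  have gens: "insert a A \<subseteq> Idl (insert a A)" "a \<in> Idl {a}" "A \<subseteq> Idl A"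
    using assms genideal_self[of "insert a A"] genideal_self'[of a] genideal_self[of A] by blast+
  have "Idl (insert a A) = Idl (Idl {a} \<union> Idl A)"
  proof
    have "insert a A \<subseteq> Idl {a} <+> Idl A"
      using gens set_add_ideals_upper[OF ideals(1,2)] by blast
    then show "Idl (insert a A) \<subseteq> Idl (Idl {a} \<union> Idl A)"
      by (simp add: union_genideal genideal_minimal add_ideals ideals)
    have "Idl {a} \<subseteq> Idl (insert a A)" and "Idl A \<subseteq> Idl (insert a A)"
      using gens(1) by (simp_all add: genideal_minimal ideals)
    then show "Idl (Idl {a} \<union> Idl A) \<subseteq> Idl (insert a A)"
      by (simp add: genideal_minimal ideals)
  qed
  then show ?thesis
    by (simp add: union_genideal ideals)
qed

text \<open>The induction on the number of generators starts at the zero ideal, which is principal.\<close>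

lemma (in cring) C_condition_finitely_generated:
  fixes \<C> :: "('a, 'm) module set"
  assumes principal: "\<And>I. principalideal I R \<Longrightarrow> C_condition R I \<C>"
    and "finite A" and "A \<subseteq> carrier R"
  shows "C_condition R (Idl A) \<C>"
  using assms(2,3)
proof induct
  case empty
  have "Idl {} = {\<zero>}"
  proof
    show "Idl {} \<subseteq> {\<zero>}"
      by (simp add: genideal_minimal zeroideal)
    show "{\<zero>} \<subseteq> Idl {}"
      by (simp add: genideal_ideal ideal.axioms(1) additive_subgroup.zero_closed)
  qed
  then show ?case
    using principal[OF zeropideal] by simp
next
  case (insert a A)
  then have a: "a \<in> carrier R" and A: "A \<subseteq> carrier R" and IH: "C_condition R (Idl A) \<C>"
    by simp_all
  have "C_condition R (Idl {a}) \<C>"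
    using principal[OF cgenideal_is_principalideal[OF a]] unfolding cgenideal_eq_genideal[OF a] .
  then have "C_condition R (Idl {a} <+> Idl A) \<C>"
    using a A IH by (intro C_condition_sum genideal_ideal) simp_all
  then show ?case
    unfolding genideal_insert[OF a A] .
qed

theorem proposition2p6:
  fixes R :: "('a, 'x) ring_scheme" (structure)
    and \<S> :: "('a, 'm) module set"
  assumes "cring R" and "noetherian_ring R"
    and "\<S> \<subseteq> R_Mod R"
  shows "(\<forall>\<aa> \<bb>. ideal \<aa> R \<and> ideal \<bb> R \<and> C_condition R \<aa> \<S> \<and> C_condition R \<bb> \<S>
            \<longrightarrow> C_condition R (\<aa> <+>\<^bsub>R\<^esub> \<bb>) \<S>)
       \<and> ((\<forall>\<aa>. principalideal \<aa> R \<longrightarrow> C_condition R \<aa> \<S>)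
            \<longrightarrow> (\<forall>\<aa>. ideal \<aa> R \<longrightarrow> C_condition R \<aa> \<S>))"
proof (intro conjI allI impI)
  show "C_condition R (\<aa> <+>\<^bsub>R\<^esub> \<bb>) \<S>"
    if "ideal \<aa> R \<and> ideal \<bb> R \<and> C_condition R \<aa> \<S> \<and> C_condition R \<bb> \<S>" for \<aa> \<bb>
    using that by (simp add: cring.C_condition_sum[OF assms(1)])
  show "C_condition R \<aa> \<S>"
    if principal: "\<forall>\<aa>. principalideal \<aa> R \<longrightarrow> C_condition R \<aa> \<S>" and "ideal \<aa> R" for \<aa>
  proof -
    obtain A where A: "A \<subseteq> carrier R" "finite A" "\<aa> = Idl\<^bsub>R\<^esub> A"
      using noetherian_ring.finetely_gen[OF assms(2) \<open>ideal \<aa> R\<close>] by blast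
    show ?thesis
      unfolding A(3)
      by (rule cring.C_condition_finitely_generated[OF assms(1) principal[rule_format] A(2,1)])
  qed
qed

end
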